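(* Let $\omega\in\mathbb{C}$ belong to the strip $|\operatorname{Im}\omega|\leq C$ where $C$ is a positive number, and suppose that $\max_{\overline{\mathbf{S}}}|S_{f}(x,t)-S_N(x,t)|\leq\varepsilon$. Let $x\in[0,b]$. (i) If $|\omega|>1$, then $$|s(\omega,x;\infty)-s_{N}(\omega,x)|\leq \varepsilon\,\frac{\sinh (Cx)}{C}.$$ (ii) If $|\omega|\leq 1$, then $$|s(\omega,x;\infty)-s_{N}(\omega,x)|\leq\varepsilon\, c_{b}\,x,$$ where the constant $c_{b}$ depends only on $b$. (iii) For any $\omega\neq 0$, $$|s(\omega,x;\infty)-s_{N}(\omega,x)|\leq\frac{\varepsilon}{|\omega|}\,\frac{\sinh(Cx)}{C}.$$
   Context: Setting. Let $b>0$, let $q:[-b,b]\to\mathbb{C}$ be continuous, and let $f\in C^{2}[-b,b]$ be a complex-valued solution of $f''-qf=0$ with $f(x)\neq 0$ on $[-b,b]$ and $f(0)=1$. Put $h:=f'(0)\in\mathbb{C}$. Let $\overline{\mathbf{S}}=[-b,b]\times[-b,b]$ in the $(x,t)$-plane. Kernel: $\mathbf{K}_{f}(x,t)=\mathbf{H}\bigl(\tfrac{x+t}{2},\tfrac{x-t}{2}\bigr)$ for $(x,t)\in\overline{\mathbf{S}}$, where $\mathbf{H}$ is the unique solution of the Goursat problem $\frac{\partial^{2}\mathbf{H}(u,v)}{\partial u\,\partial v}=q(u+v)\mathbf{H}(u,v)$, $\mathbf{H}(u,0)=\frac h2+\frac12\int_0^u q(s)\,ds$, $\mathbf{H}(0,v)=\frac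 h2$. Put $S_f(x,t)=\mathbf{K}_f(x,t)-\mathbf{K}_f(x,-t)$. $s(\omega,x;\infty)$ denotes the solution of $u''-q(x)u+\omega^2u=0$ with $s(\omega,0;\infty)=0$, $s'_x(\omega,0;\infty)=1$. It is known that $s(\omega,x;\infty)=\frac{\sin\omega x}{\omega}+\int_0^x S_f(x,t)\frac{\sin\omega t}{\omega}\,dt$. For $\omega=0$ the expression $\frac{\sin\omega t}{\omega}$ is understood as $t$. Recursive integrals: $X^{(0)}\equiv \widetilde X^{(0)}\equiv 1$ and, for $n\ge 1$, $X^{(n)}(x)=n\int_{0}^{x}X^{(n-1)}(s)(f^{2}(s))^{(-1)^{n}}ds$, $\widetilde X^{(n)}(x)=n\int_{0}^{x}\widetilde X^{(n-1)}(s)(f^{2}(s))^{(-1)^{n-1}}ds$. Put $\varphi_k=fX^{(k)}$ for $k$ odd and $\varphi_k=f\widetilde X^{(k)}$ for $k$ even; $u_{2n}(x,t)=\sum_{1\le k\le n,\ k\text{ odd}}\binom nk\varphi_{n-k}(x)t^k$ for $n\ge1$. For $N\in\mathbb{N}$ and given complex coefficients $b_1,\dots,b_N$, $$S_N(x,t)=2\sum_{n=1}^N b_nu_{2n}(x,t),\qquad s_N(\omega,x)=\frac{\sin\omega x}{\omega}+\int_0^x S_N(x,t)\frac{\sin\omega t}{\omega}\,dt .$$ *)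

theory Defs
  imports "HOL-Analysis.Analysis"
begin

text \<open>
  Integrals from 0 to x are oriented (x may be negative), hence interval Lebesgue integrals
  \<open>LBINT s=a..b\<close>.
\<close>

text \<open>
  \<open>u\<close> belongs to $C^2[-b,b]$ and solves $u'' - q u + \omega^2 u = 0$ on $[-b,b]$; the derivatives at
  the end points are one-sided. For $\omega = 0$ this is the equation $u'' - q u = 0$.
\<close>
definition schroedinger_solution ::
    "real \<Rightarrow> (real \<Rightarrow> complex) \<Rightarrow> complex \<Rightarrow> (real \<Rightarrow> complex) \<Rightarrow> bool" where
  "schroedinger_solution b q \<omega> u \<longleftrightarrow>
     (\<exists>u' u''. continuous_on {-b..b} u'' \<and>
        (\<forall>x\<in>{-b..b}. (u has_vector_derivative u' x) (at x within {-b..b}) \<and>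
                     (u' has_vector_derivative u'' x) (at x within {-b..b}) \<and>
                     u'' x - q x * u x + \<omega>\<^sup>2 * u x = 0))"

text \<open>\<open>s\<close> is the function $s(\omega, \cdot\,; \infty)$ on $[-b,b]$.\<close>
definition is_s_solution ::
    "real \<Rightarrow> (real \<Rightarrow> complex) \<Rightarrow> complex \<Rightarrow> (real \<Rightarrow> complex) \<Rightarrow> bool" where
  "is_s_solution b q \<omega> s \<longleftrightarrow>
     schroedinger_solution b q \<omega> s \<and> s 0 = 0 \<and> vector_derivative s (at 0) = 1"

text \<open>
  The Goursat problem, on the image $|u|+|v| \le b$ of the square $[-b,b]^2$ under
  $(x,t) \mapsto ((x+t)/2, (x-t)/2)$. The solution is continuous on the closed region; the
  differential equation is imposed in its interior, since at the corners the partial derivatives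
  within the closed region make no sense. \<open>Hv\<close> is $\partial H/\partial v$.
  Continuity together with these conditions determines \<open>H\<close> uniquely on the closed region.
\<close>
definition goursat_solution ::
    "real \<Rightarrow> (real \<Rightarrow> complex) \<Rightarrow> complex \<Rightarrow> (real \<Rightarrow> real \<Rightarrow> complex) \<Rightarrow> bool" where
  "goursat_solution b q h H \<longleftrightarrow>
     continuous_on {(u, v). \<bar>u\<bar> + \<bar>v\<bar> \<le> b} (\<lambda>(u, v). H u v) \<and>
     (\<exists>Hv. \<forall>u v. \<bar>u\<bar> + \<bar>v\<bar> < b \<longrightarrow>
        ((\<lambda>v. H u v) has_vector_derivative Hv u v) (at v) \<and>
        ((\<lambda>u. Hv u v) has_vector_derivative q (u + v) * H u v) (at u)) \<and>
     (\<forall>u\<in>{-b..b}. H u 0 = h / 2 + 1 / 2 * (LBINT s=0..u. q s)) \<and>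
     (\<forall>v\<in>{-b..b}. H 0 v = h / 2)"

definition K_kernel :: "(real \<Rightarrow> real \<Rightarrow> complex) \<Rightarrow> real \<Rightarrow> real \<Rightarrow> complex" where
  "K_kernel H x t = H ((x + t) / 2) ((x - t) / 2)"

definition S_kernel :: "(real \<Rightarrow> real \<Rightarrow> complex) \<Rightarrow> real \<Rightarrow> real \<Rightarrow> complex" where
  "S_kernel H x t = K_kernel H x t - K_kernel H x (- t)"

definition sin_quot :: "complex \<Rightarrow> real \<Rightarrow> complex" where
  "sin_quot \<omega> t = (if \<omega> = 0 then of_real t else sin (\<omega> * of_real t) / \<omega>)"

primrec X :: "(real \<Rightarrow> complex) \<Rightarrow> nat \<Rightarrow> real \<Rightarrow> complex" where
  "X f 0 = (\<lambda>x. 1)"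
| "X f (Suc n) = (\<lambda>x. of_nat (Suc n) *
     (LBINT s=0..x. X f n s * ((f s)\<^sup>2) powi ((-1) ^ Suc n)))"

primrec X_tilde :: "(real \<Rightarrow> complex) \<Rightarrow> nat \<Rightarrow> real \<Rightarrow> complex" where
  "X_tilde f 0 = (\<lambda>x. 1)"
| "X_tilde f (Suc n) = (\<lambda>x. of_nat (Suc n) *
     (LBINT s=0..x. X_tilde f n s * ((f s)\<^sup>2) powi ((-1) ^ n)))"

definition phi :: "(real \<Rightarrow> complex) \<Rightarrow> nat \<Rightarrow> real \<Rightarrow> complex" where
  "phi f k x = f x * (if odd k then X f k x else X_tilde f k x)"

text \<open>\<open>u_even f n\<close> is the wave polynomial $u_{2n}$.\<close>
definition u_even :: "(real \<Rightarrow> complex) \<Rightarrow> nat \<Rightarrow> real \<Rightarrow> real \<Rightarrow> complex" where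
  "u_even f n x t =
     (\<Sum>k | 1 \<le> k \<and> k \<le> n \<and> odd k. of_nat (n choose k) * phi f (n - k) x * of_real t ^ k)"

definition S_approx ::
    "(real \<Rightarrow> complex) \<Rightarrow> (nat \<Rightarrow> complex) \<Rightarrow> nat \<Rightarrow> real \<Rightarrow> real \<Rightarrow> complex" where
  "S_approx f \<beta> N x t = 2 * (\<Sum>n = 1..N. \<beta> n * u_even f n x t)"

definition s_approx ::
    "(real \<Rightarrow> complex) \<Rightarrow> (nat \<Rightarrow> complex) \<Rightarrow> nat \<Rightarrow> complex \<Rightarrow> real \<Rightarrow> complex" where
  "s_approx f \<beta> N \<omega> x =
     sin_quot \<omega> x + (LBINT t=0..x. S_approx f \<beta> N x t * sin_quot \<omega> t)"

end

theory Submission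
  imports Defs
begin

text \<open>
  Put $\sigma(t) = \sin(\omega t)/\omega$ and $T(x) = \sigma(x) + \int_0^x S_f(x,t)\,\sigma(t)\,dt$.
  In characteristic coordinates the integral is $2\int_0^x H(u,x-u)\,\sigma(2u-x)\,du$. Since
  $\int_\alpha^\gamma \sigma(2u-x)\,du = \sigma(\gamma-\alpha)\,\sigma(\alpha+\gamma-x)$, inserting the
  integrated form of the Goursat problem and applying Fubini's theorem on the triangle
  $\alpha,\beta\ge 0$, $\alpha+\beta\le x$ yields the Volterra equation
  $T(x) = \sigma(x) + \int_0^x \sigma(x-y)\,q(y)\,T(y)\,dy$. This needs no regularity of $q$ beyond
  continuity. Variation of constants gives the same equation for $s(\omega,\cdot;\infty)$, so $T = s$ by
  uniqueness. Hence $s - s_N = \int_0^x (S_f - S_N)\,\sigma$, and the estimates follow from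
  $|\sin(\omega t)| \le \cosh(Ct)$ in the strip and, for $|\omega| \le 1$, from
  $|\sigma(t)| \le b\,e^b$ on $[0,b]$.
\<close>

subsection \<open>The function $\sin(\omega t)/\omega$\<close>

lemma sin_quot_zero [simp]: "sin_quot \<omega> 0 = 0"
  by (simp add: sin_quot_def)

lemma sin_quot_minus [simp]: "sin_quot \<omega> (- t) = - sin_quot \<omega> t"
  by (simp add: sin_quot_def)

lemma sin_quot_add:
  "sin_quot \<omega> (s + t) = sin_quot \<omega> s * cos (\<omega> * of_real t) + cos (\<omega> * of_real s) * sin_quot \<omega> t"
  by (simp add: sin_quot_def distrib_left sin_add add_divide_distrib)

text \<open>Write \<sigma> for \<open>sin_quot \<omega>\<close>. The value t chosen at \<omega> = 0
  fits the same rule, since cos 0 = 1. Together with the derivative of the cosine below, this lets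
  all later calculus treat every \<omega> alike, without dividing by \<omega>.\<close>

lemma has_vector_derivative_sin_quot:
  "(sin_quot \<omega> has_vector_derivative cos (\<omega> * of_real t)) (at t within S)"
proof (cases "\<omega> = 0")
  case True
  then show ?thesis
    by (auto simp: sin_quot_def[abs_def] intro!: derivative_eq_intros)
next
  case False
  have "((\<lambda>z. sin (\<omega> * z) / \<omega>) has_field_derivative cos (\<omega> * of_real t)) (at (of_real t))"
    using False by (auto intro!: derivative_eq_intros)
  from has_vector_derivative_real_field[OF this] False show ?thesis
    by (simp add: sin_quot_def[abs_def])
qed

lemma has_vector_derivative_cos_mult:
  "((\<lambda>t. cos (\<omega> * of_real t)) has_vector_derivative - \<omega>\<^sup>2 * sin_quot \<omega> t) (at t within S)"
proof -
  have "((\<lambda>z. cos (\<omega> * z)) has_field_derivative - \<omega>\<^sup>2 * sin_quot \<omega> t) (at (of_real t))"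
    by (auto intro!: derivative_eq_intros simp: sin_quot_def power2_eq_square)
  from has_vector_derivative_real_field[OF this] show ?thesis .
qed


lemma continuous_on_sin_quot [continuous_intros]:
  assumes "continuous_on S g"
  shows "continuous_on S (\<lambda>x. sin_quot \<omega> (g x))"
proof -
  have "continuous_on UNIV (sin_quot \<omega>)"
    using has_vector_derivative_sin_quot has_vector_derivative_continuous
    by (metis continuous_at_imp_continuous_on)
  then show ?thesis
    using assms continuous_on_compose2 by blast
qed

text \<open>The arguments u - a and u + a - x add up to 2u - x, so the product rule produces exactly
  the right side of the addition formula for \<sigma>(2u - x). The lemma provides a primitive that
  vanishes at u = a.\<close>

lemma has_vector_derivative_sin_quot_mult:
  "((\<lambda>u. sin_quot \<omega> (u - a) * sin_quot \<omega> (u + a - x)) has_vector_derivative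
    sin_quot \<omega> (2 * u - x)) (at u within S)"
proof (rule has_vector_derivative_eq_rhs)
  have shift: "((\<lambda>u. sin_quot \<omega> (u + d)) has_vector_derivative cos (\<omega> * of_real (u + d)))
      (at u within S)" for d
  proof -
    have "((\<lambda>u. u + d) has_vector_derivative 1) (at u within S)"
      by (auto intro!: derivative_eq_intros)
    from vector_diff_chain_within[OF this has_vector_derivative_sin_quot] show ?thesis
      by (simp add: o_def)
  qed
  show "((\<lambda>u. sin_quot \<omega> (u - a) * sin_quot \<omega> (u + a - x)) has_vector_derivative
      sin_quot \<omega> (u - a) * cos (\<omega> * of_real (u + (a - x))) +
      cos (\<omega> * of_real (u + - a)) * sin_quot \<omega> (u + (a - x))) (at u within S)"
    using has_vector_derivative_mult[OF shift[of "- a"] shift[of "a - x"]]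
    by (simp add: algebra_simps)
  have "2 * u - x = (u - a) + (u + (a - x))" by simp
  then show "sin_quot \<omega> (u - a) * cos (\<omega> * of_real (u + (a - x))) +
      cos (\<omega> * of_real (u + - a)) * sin_quot \<omega> (u + (a - x)) = sin_quot \<omega> (2 * u - x)"
    by (simp only: sin_quot_add) simp
qed

lemma has_integral_sin_quot:
  assumes "a \<le> c"
  shows "((\<lambda>u. sin_quot \<omega> (2 * u - x)) has_integral
    sin_quot \<omega> (c - a) * sin_quot \<omega> (a + c - x)) {a..c}"
  using fundamental_theorem_of_calculus[OF assms has_vector_derivative_sin_quot_mult[of \<omega> a x]]
  by (simp add: algebra_simps)

section \<open>Growth bounds in the strip and in the unit disc\<close>

text \<open>In the exponential form of the sine the two terms have moduli exp(- Im z) and exp(Im z);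
  the triangle inequality does the rest.\<close>

lemma norm_sin_le_cosh: "norm (sin z) \<le> cosh (Im z)" for z :: complex
proof -
  have "norm (exp (\<i> * z) - exp (- (\<i> * z))) \<le> exp (- Im z) + exp (Im z)"
    using norm_triangle_ineq4[of "exp (\<i> * z)" "exp (- (\<i> * z))"] by simp
  then show ?thesis
    by (simp add: sin_exp_eq norm_divide norm_mult cosh_def)
qed

lemma norm_cos_le_cosh: "norm (cos z) \<le> cosh (Im z)" for z :: complex
proof -
  have "norm (exp (\<i> * z) + exp (- (\<i> * z))) \<le> exp (- Im z) + exp (Im z)"
    using norm_triangle_ineq[of "exp (\<i> * z)" "exp (- (\<i> * z))"] by simp
  then show ?thesis
    by (simp add: cos_exp_eq norm_divide norm_mult cosh_def)
qed

lemma cosh_mono_abs: "\<bar>x\<bar> \<le> \<bar>y\<bar> \<Longrightarrow> cosh x \<le> cosh y" for x y :: real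
  by (metis abs_ge_zero cosh_real_abs cosh_real_nonneg_le_iff)

text \<open>The imaginary part of \<omega>t is t Im \<omega>, and cosh is even and increases with
  the modulus. Integrating this majorant over [0,x] gives the sinh term of (i) and (iii).\<close>

lemma norm_sin_quot_le_cosh:
  assumes "\<omega> \<noteq> 0" "\<bar>Im \<omega>\<bar> \<le> C"
  shows "norm (sin_quot \<omega> t) \<le> cosh (C * t) / norm \<omega>"
proof -
  have "\<bar>Im \<omega> * t\<bar> \<le> \<bar>C * t\<bar>"
    using assms(2) by (auto simp: abs_mult intro!: mult_right_mono)
  then have "norm (sin (\<omega> * of_real t)) \<le> cosh (C * t)"
    using norm_sin_le_cosh[of "\<omega> * of_real t"] cosh_mono_abs by fastforce
  then show ?thesis
    using assms(1) by (simp add: sin_quot_def norm_divide divide_right_mono)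
qed

text \<open>Mean value inequality from \<sigma>(0) = 0: the derivative cos(\<omega>u) is at most
  cosh b, hence at most exp b, because |Im \<omega>| u is at most b. The bound is uniform down to
  \<omega> = 0 and is the source of the constant in (ii).\<close>

lemma norm_sin_quot_le_exp:
  assumes "norm \<omega> \<le> 1" "0 \<le> t" "t \<le> b"
  shows "norm (sin_quot \<omega> t) \<le> b * exp b"
proof -
  have "norm (sin_quot \<omega> t - sin_quot \<omega> 0) \<le> exp b * norm (t - 0)"
  proof (rule differentiable_bound)
    show "convex {0..b}" by simp
    show "(sin_quot \<omega> has_derivative (\<lambda>h. h *\<^sub>R cos (\<omega> * of_real u))) (at u within {0..b})" for u
      using has_vector_derivative_sin_quot unfolding has_vector_derivative_def .
    show "onorm (\<lambda>h. h *\<^sub>R cos (\<omega> * of_real u)) \<le> exp b" if "u \<in> {0..b}" for u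
    proof (rule onorm_le)
      fix h :: real
      have "\<bar>Im \<omega> * u\<bar> \<le> 1 * b"
        unfolding abs_mult using that assms abs_Im_le_cmod[of \<omega>] by (intro mult_mono) auto
      then have "norm (cos (\<omega> * of_real u)) \<le> cosh b"
        using norm_cos_le_cosh[of "\<omega> * of_real u"] cosh_mono_abs[of "Im \<omega> * u" b] by fastforce
      also have "\<dots> \<le> exp b"
        using assms by (simp add: cosh_def)
      finally show "norm (h *\<^sub>R cos (\<omega> * of_real u)) \<le> exp b * norm h"
        by (simp add: mult.commute mult_left_mono)
    qed
  qed (use assms in auto)
  also have "\<dots> \<le> exp b * b"
    using assms by simp
  finally show ?thesis
    by (simp add: mult.commute)
qed

subsection \<open>Fubini's theorem on a triangle\<close>

lemma closed_subset_compact: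
  fixes S :: "'a::t2_space set"
  assumes "closed S" "S \<subseteq> T" "compact T"
  shows "compact S"
  using closed_Int_compact[OF assms(1,3)] assms(2) by (simp add: Int_absorb2)

text \<open>Extended by zero off \<open>K\<close>, f is Lebesgue integrable on the product space, so
  Fubini applies. Sections of a compact set are compact, which turns the inner Lebesgue integrals
  back into gauge integrals. Having both orders allows an interchange by passing through the
  integral over \<open>K\<close>.\<close>

lemma integral_compact_eq_iterated:
  fixes f :: "'a::euclidean_space \<times> 'b::euclidean_space \<Rightarrow> 'c::euclidean_space"
  assumes K: "compact K" and f: "continuous_on K f"
  shows "integral K f = integral UNIV (\<lambda>x. integral {y. (x, y) \<in> K} (\<lambda>y. f (x, y)))"
    and "integral K f = integral UNIV (\<lambda>y. integral {x. (x, y) \<in> K} (\<lambda>x. f (x, y)))"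
proof -
  let ?g = "\<lambda>p. indicator K p *\<^sub>R f p"
  have int: "integrable (lborel \<Otimes>\<^sub>M lborel) ?g"
    using borel_integrable_compact[OF K f] by (simp add: lborel_prod)
  have eq: "(\<integral>p. ?g p \<partial>lborel) = integral K f"
    using set_borel_integral_eq_integral(2)[of K f] borel_integrable_compact[OF K f]
    by (simp add: set_integrable_def set_lebesgue_integral_def)
  have fst_sec: "(\<integral>y. ?g (x, y) \<partial>lborel) = integral {y. (x, y) \<in> K} (\<lambda>y. f (x, y))" for x
  proof -
    have sec: "compact {y. (x, y) \<in> K}"
    proof -
      have "{y. (x, y) \<in> K} = snd ` (K \<inter> ({x} \<times> UNIV))" by force
      moreover have "compact (K \<inter> ({x} \<times> UNIV))"
        by (intro compact_Int_closed K closed_Times) auto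
      ultimately show ?thesis
        by (simp add: compact_continuous_image continuous_on_snd)
    qed
    have "continuous_on {y. (x, y) \<in> K} (\<lambda>y. f (x, y))"
      by (rule continuous_on_compose2[OF f]) (auto intro!: continuous_intros)
    from set_borel_integral_eq_integral(2)[of "{y. (x, y) \<in> K}" "\<lambda>y. f (x, y)"]
      borel_integrable_compact[OF sec this]
    show ?thesis
      by (simp add: set_integrable_def set_lebesgue_integral_def indicator_def)
  qed
  have snd_sec: "(\<integral>x. ?g (x, y) \<partial>lborel) = integral {x. (x, y) \<in> K} (\<lambda>x. f (x, y))" for y
  proof -
    have sec: "compact {x. (x, y) \<in> K}"
    proof -
      have "{x. (x, y) \<in> K} = fst ` (K \<inter> (UNIV \<times> {y}))" by force
      moreover have "compact (K \<inter> (UNIV \<times> {y}))"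
        by (intro compact_Int_closed K closed_Times) auto
      ultimately show ?thesis
        by (simp add: compact_continuous_image continuous_on_fst)
    qed
    have "continuous_on {x. (x, y) \<in> K} (\<lambda>x. f (x, y))"
      by (rule continuous_on_compose2[OF f]) (auto intro!: continuous_intros)
    from set_borel_integral_eq_integral(2)[of "{x. (x, y) \<in> K}" "\<lambda>x. f (x, y)"]
      borel_integrable_compact[OF sec this]
    show ?thesis
      by (simp add: set_integrable_def set_lebesgue_integral_def indicator_def)
  qed
  have "integral K f = (\<integral>x. (\<integral>y. ?g (x, y) \<partial>lborel) \<partial>lborel)"
    using lborel_pair.integral_fst'[OF int] eq by (simp add: lborel_prod)
  also have "\<dots> = integral UNIV (\<lambda>x. (\<integral>y. ?g (x, y) \<partial>lborel))"
    using lborel_pair.integrable_fst'[OF int] by (rule integral_lborel[symmetric])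
  finally show "integral K f = integral UNIV (\<lambda>x. integral {y. (x, y) \<in> K} (\<lambda>y. f (x, y)))"
    by (simp only: fst_sec)
  have int': "integrable (lborel \<Otimes>\<^sub>M lborel) (\<lambda>(x, y). ?g (x, y))"
    using int by (simp only: case_prod_unfold prod.collapse)
  have "integral K f = (\<integral>y. (\<integral>x. ?g (x, y) \<partial>lborel) \<partial>lborel)"
    using lborel_pair.integral_snd[OF int'] eq by (simp add: lborel_prod case_prod_unfold)
  also have "\<dots> = integral UNIV (\<lambda>y. (\<integral>x. ?g (x, y) \<partial>lborel))"
    using lborel_pair.integrable_snd[OF int'] by (intro integral_lborel[symmetric])
  finally show "integral K f = integral UNIV (\<lambda>y. integral {x. (x, y) \<in> K} (\<lambda>x. f (x, y)))"
    by (simp only: snd_sec)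
qed

lemma integral_UNIV_support:
  fixes f :: "'a::euclidean_space \<Rightarrow> 'b::banach"
  assumes "\<And>x. x \<notin> S \<Longrightarrow> f x = 0"
  shows "integral UNIV f = integral S f"
proof -
  have "f = (\<lambda>x. if x \<in> S then f x else 0)"
    using assms by auto
  then show ?thesis
    using Henstock_Kurzweil_Integration.integral_restrict_UNIV[of S f] by simp
qed

text \<open>This is the union of the rectangles [0,u] x [0,x-u] for u in [0,x], over which the
  Goursat integral equation integrates.\<close>

definition triangle :: "real \<Rightarrow> (real \<times> real) set" where
  "triangle x = {(\<alpha>, \<beta>). 0 \<le> \<alpha> \<and> 0 \<le> \<beta> \<and> \<alpha> + \<beta> \<le> x}"

lemma compact_triangle: "compact (triangle x)"
proof (rule closed_subset_compact)
  show "closed (triangle x)"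
    unfolding triangle_def split_beta
    by (intro closed_Collect_conj closed_Collect_le continuous_intros)
  show "triangle x \<subseteq> {0..x} \<times> {0..x}"
    by (auto simp: triangle_def)
qed (intro compact_Times compact_Icc)

text \<open>The shear y = \<alpha> + \<beta> carries the triangle to \<open>T\<close> and preserves
  measure, being a translation on each section of fixed \<alpha>. Interchanging the order over
  \<open>T\<close> then puts y outside.\<close>

lemma integral_triangle_diagonals:
  fixes F :: "real \<Rightarrow> real \<Rightarrow> 'a::euclidean_space"
  assumes F: "continuous_on (triangle x) (\<lambda>(\<alpha>, \<beta>). F \<alpha> \<beta>)"
  shows "integral (triangle x) (\<lambda>(\<alpha>, \<beta>). F \<alpha> \<beta>) =
    integral {0..x} (\<lambda>y. integral {0..y} (\<lambda>\<alpha>. F \<alpha> (y - \<alpha>)))"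
proof -
  define T where "T = {(\<alpha>, y). 0 \<le> \<alpha> \<and> \<alpha> \<le> y \<and> y \<le> x}"
  have T: "compact T"
  proof (rule closed_subset_compact)
    show "closed T"
      unfolding T_def split_beta
      by (intro closed_Collect_conj closed_Collect_le continuous_intros)
    show "T \<subseteq> {0..x} \<times> {0..x}"
      by (auto simp: T_def)
  qed (intro compact_Times compact_Icc)
  have FT: "continuous_on T (\<lambda>(\<alpha>, y). F \<alpha> (y - \<alpha>))"
  proof -
    have "continuous_on T (\<lambda>p. (\<lambda>(\<alpha>, \<beta>). F \<alpha> \<beta>) (fst p, snd p - fst p))"
      by (rule continuous_on_compose2[OF F])
        (auto intro!: continuous_intros simp: T_def triangle_def)
    then show ?thesis by (simp add: split_beta)
  qed
  \<comment> \<open>For negative \<alpha> both sections are empty; otherwise they are intervals that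
    differ by the translation \<alpha>.\<close>
  have shift: "integral {\<beta>. (\<alpha>, \<beta>) \<in> triangle x} (\<lambda>\<beta>. F \<alpha> \<beta>) =
      integral {y. (\<alpha>, y) \<in> T} (\<lambda>y. F \<alpha> (y - \<alpha>))" for \<alpha>
  proof (cases "0 \<le> \<alpha>")
    case True
    have "{\<beta>. (\<alpha>, \<beta>) \<in> triangle x} = {0..x - \<alpha>}" "{y. (\<alpha>, y) \<in> T} = {\<alpha>..x}"
      using True by (auto simp: triangle_def T_def)
    moreover have "((\<lambda>y. F \<alpha> (y - \<alpha>)) has_integral i) {\<alpha>..x} \<longleftrightarrow> (F \<alpha> has_integral i) {0..x - \<alpha>}" for i
      using has_integral_affinity_iff[of 1 "F \<alpha>" "- \<alpha>" i 0 "x - \<alpha>"] by simp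
    ultimately show ?thesis
      by (simp add: integral_def integrable_on_def)
  qed (simp add: triangle_def T_def)
  have "integral (triangle x) (\<lambda>(\<alpha>, \<beta>). F \<alpha> \<beta>) = integral T (\<lambda>(\<alpha>, y). F \<alpha> (y - \<alpha>))"
    by (simp add: integral_compact_eq_iterated(1)[OF compact_triangle F]
        integral_compact_eq_iterated(1)[OF T FT] shift)
  also have "\<dots> = integral UNIV (\<lambda>y. integral {\<alpha>. (\<alpha>, y) \<in> T} (\<lambda>\<alpha>. F \<alpha> (y - \<alpha>)))"
    by (simp add: integral_compact_eq_iterated(2)[OF T FT])
  also have "\<dots> = integral {0..x} (\<lambda>y. integral {\<alpha>. (\<alpha>, y) \<in> T} (\<lambda>\<alpha>. F \<alpha> (y - \<alpha>)))"
  proof (rule integral_UNIV_support)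
    show "integral {\<alpha>. (\<alpha>, y) \<in> T} (\<lambda>\<alpha>. F \<alpha> (y - \<alpha>)) = 0" if "y \<notin> {0..x}" for y
    proof -
      have "{\<alpha>. (\<alpha>, y) \<in> T} = {}" using that by (auto simp: T_def)
      then show ?thesis by simp
    qed
  qed
  also have "\<dots> = integral {0..x} (\<lambda>y. integral {0..y} (\<lambda>\<alpha>. F \<alpha> (y - \<alpha>)))"
  proof (rule integral_cong)
    fix y assume "y \<in> {0..x}"
    then have "{\<alpha>. (\<alpha>, y) \<in> T} = {0..y}" by (auto simp: T_def)
    then show "integral {\<alpha>. (\<alpha>, y) \<in> T} (\<lambda>\<alpha>. F \<alpha> (y - \<alpha>)) =
        integral {0..y} (\<lambda>\<alpha>. F \<alpha> (y - \<alpha>))" by simp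
  qed
  finally show ?thesis .
qed

text \<open>Fubini on the three-dimensional set \<open>K\<close>: fixing u leaves the rectangle,
  while fixing a point (\<alpha>, \<beta>) of the triangle leaves the u with \<alpha> \<le> u \<le>
  x - \<beta>, over which only p still varies.\<close>

lemma integral_mult_rectangle_integrals:
  fixes p :: "real \<Rightarrow> complex" and G :: "real \<Rightarrow> real \<Rightarrow> complex"
  assumes p: "continuous_on {0..x} p"
    and G: "continuous_on (triangle x) (\<lambda>(\<alpha>, \<beta>). G \<alpha> \<beta>)"
  shows "integral {0..x} (\<lambda>u. p u * integral ({0..u} \<times> {0..x - u}) (\<lambda>(\<alpha>, \<beta>). G \<alpha> \<beta>)) =
    integral (triangle x) (\<lambda>(\<alpha>, \<beta>). G \<alpha> \<beta> * integral {\<alpha>..x - \<beta>} p)"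
proof -
  define K :: "(real \<times> real \<times> real) set"
    where "K = {(u, \<alpha>, \<beta>). 0 \<le> \<alpha> \<and> \<alpha> \<le> u \<and> 0 \<le> \<beta> \<and> \<beta> \<le> x - u}"
  have K: "compact K"
  proof (rule closed_subset_compact)
    show "closed K"
      unfolding K_def split_beta
      by (intro closed_Collect_conj closed_Collect_le continuous_intros)
    show "K \<subseteq> {0..x} \<times> {0..x} \<times> {0..x}"
      by (auto simp: K_def)
  qed (intro compact_Times compact_Icc)
  have pG: "continuous_on K (\<lambda>(u, \<alpha>, \<beta>). p u * G \<alpha> \<beta>)"
  proof -
    have "continuous_on K (\<lambda>z. p (fst z))"
      by (rule continuous_on_compose2[OF p]) (auto intro!: continuous_intros simp: K_def)
    moreover have "continuous_on K (\<lambda>z. (\<lambda>(\<alpha>, \<beta>). G \<alpha> \<beta>) (snd z))"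
      by (rule continuous_on_compose2[OF G]) (auto intro!: continuous_intros simp: K_def triangle_def)
    ultimately have "continuous_on K (\<lambda>z. p (fst z) * (\<lambda>(\<alpha>, \<beta>). G \<alpha> \<beta>) (snd z))"
      by (rule continuous_on_mult)
    then show ?thesis by (simp add: split_beta)
  qed
  have "integral {0..x} (\<lambda>u. p u * integral ({0..u} \<times> {0..x - u}) (\<lambda>(\<alpha>, \<beta>). G \<alpha> \<beta>)) =
      integral {0..x} (\<lambda>u. integral {w. (u, w) \<in> K} (\<lambda>w. (\<lambda>(u, \<alpha>, \<beta>). p u * G \<alpha> \<beta>) (u, w)))"
  proof (rule integral_cong)
    fix u assume "u \<in> {0..x}"
    have "{w. (u, w) \<in> K} = {0..u} \<times> {0..x - u}" by (auto simp: K_def)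
    then show "p u * integral ({0..u} \<times> {0..x - u}) (\<lambda>(\<alpha>, \<beta>). G \<alpha> \<beta>) =
        integral {w. (u, w) \<in> K} (\<lambda>w. (\<lambda>(u, \<alpha>, \<beta>). p u * G \<alpha> \<beta>) (u, w))"
      by (simp add: case_prod_unfold)
  qed
  also have "\<dots> = integral UNIV (\<lambda>u. integral {w. (u, w) \<in> K} (\<lambda>w. (\<lambda>(u, \<alpha>, \<beta>). p u * G \<alpha> \<beta>) (u, w)))"
  proof (rule integral_UNIV_support[symmetric])
    show "integral {w. (u, w) \<in> K} (\<lambda>w. (\<lambda>(u, \<alpha>, \<beta>). p u * G \<alpha> \<beta>) (u, w)) = 0" if "u \<notin> {0..x}" for u
    proof -
      have "{w. (u, w) \<in> K} = {}" using that by (auto simp: K_def)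
      then show ?thesis by (simp only: integral_empty)
    qed
  qed
  also have "\<dots> = integral UNIV (\<lambda>w. integral {u. (u, w) \<in> K} (\<lambda>u. (\<lambda>(u, \<alpha>, \<beta>). p u * G \<alpha> \<beta>) (u, w)))"
    by (simp only: integral_compact_eq_iterated(1)[OF K pG, symmetric]
        integral_compact_eq_iterated(2)[OF K pG, symmetric])
  also have "\<dots> = integral (triangle x)
      (\<lambda>w. integral {u. (u, w) \<in> K} (\<lambda>u. (\<lambda>(u, \<alpha>, \<beta>). p u * G \<alpha> \<beta>) (u, w)))"
  proof (rule integral_UNIV_support)
    show "integral {u. (u, w) \<in> K} (\<lambda>u. (\<lambda>(u, \<alpha>, \<beta>). p u * G \<alpha> \<beta>) (u, w)) = 0"
      if "w \<notin> triangle x" for w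
    proof -
      have "{u. (u, w) \<in> K} = {}" using that by (auto simp: K_def triangle_def)
      then show ?thesis by (simp only: integral_empty)
    qed
  qed
  also have "\<dots> = integral (triangle x) (\<lambda>(\<alpha>, \<beta>). G \<alpha> \<beta> * integral {\<alpha>..x - \<beta>} p)"
  proof (rule integral_cong)
    fix w assume "w \<in> triangle x"
    then obtain \<alpha> \<beta> where w: "w = (\<alpha>, \<beta>)" "0 \<le> \<alpha>" "0 \<le> \<beta>" by (auto simp: triangle_def)
    have "{u. (u, w) \<in> K} = {\<alpha>..x - \<beta>}" using w by (auto simp: K_def)
    then show "integral {u. (u, w) \<in> K} (\<lambda>u. (\<lambda>(u, \<alpha>, \<beta>). p u * G \<alpha> \<beta>) (u, w)) =
        (case w of (\<alpha>, \<beta>) \<Rightarrow> G \<alpha> \<beta> * integral {\<alpha>..x - \<beta>} p)"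
      using w by (simp add: mult.commute)
  qed
  finally show ?thesis .
qed

subsection \<open>Volterra equations\<close>

text \<open>The strict inequality keeps the rectangle inside the open region where the differential equation holds.\<close>

lemma goursat_integral_equation:
  assumes H: "goursat_solution b q h H" and q: "continuous_on {-b..b} q"
    and uv: "0 \<le> u" "0 \<le> v" "u + v < b"
  shows "H u v = h / 2 + 1 / 2 * integral {0..u} q +
    integral ({0..u} \<times> {0..v}) (\<lambda>(\<alpha>, \<beta>). q (\<alpha> + \<beta>) * H \<alpha> \<beta>)"
proof -
  define G where "G = (\<lambda>(\<alpha>, \<beta>). q (\<alpha> + \<beta>) * H \<alpha> \<beta>)"
  obtain Hv where
    Hv: "\<And>u v. \<bar>u\<bar> + \<bar>v\<bar> < b \<Longrightarrow> ((\<lambda>v. H u v) has_vector_derivative Hv u v) (at v)" and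
    Hvu: "\<And>u v. \<bar>u\<bar> + \<bar>v\<bar> < b \<Longrightarrow> ((\<lambda>u. Hv u v) has_vector_derivative q (u + v) * H u v) (at u)"
    using H unfolding goursat_solution_def by blast
  have H_cont: "continuous_on {(u, v). \<bar>u\<bar> + \<bar>v\<bar> \<le> b} (\<lambda>(u, v). H u v)"
    and H0v: "\<And>v. v \<in> {-b..b} \<Longrightarrow> H 0 v = h / 2"
    and Hu0: "\<And>u. u \<in> {-b..b} \<Longrightarrow> H u 0 = h / 2 + 1 / 2 * (LBINT s=0..u. q s)"
    using H unfolding goursat_solution_def by blast+
  \<comment> \<open>H is constant on the characteristic u = 0, so its derivative along that line
    vanishes. This removes the boundary term when the differential equation is integrated in
    u.\<close>
  have Hv0: "Hv 0 \<beta> = 0" if "\<bar>\<beta>\<bar> < b" for \<beta>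
  proof -
    have "((\<lambda>v. h / 2) has_vector_derivative Hv 0 \<beta>) (at \<beta>)"
    proof (rule has_vector_derivative_transform_within_open)
      show "((\<lambda>v. H 0 v) has_vector_derivative Hv 0 \<beta>) (at \<beta>)"
        using that by (intro Hv) simp
      show "H 0 v = h / 2" if "v \<in> {-b<..<b}" for v
        using that by (intro H0v) simp
    qed (use that in auto)
    then show ?thesis
      using vector_derivative_at by fastforce
  qed
  have Hv_eq: "Hv u \<beta> = integral {0..u} (\<lambda>\<alpha>. G (\<alpha>, \<beta>))" if \<beta>: "\<beta> \<in> {0..v}" for \<beta>
  proof -
    have "((\<lambda>\<alpha>. q (\<alpha> + \<beta>) * H \<alpha> \<beta>) has_integral Hv u \<beta> - Hv 0 \<beta>) {0..u}"
      using uv \<beta> by (intro fundamental_theorem_of_calculus has_vector_derivative_at_within[OF Hvu]) auto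
    then show ?thesis
      using Hv0[of \<beta>] \<beta> uv by (simp add: integral_unique G_def)
  qed
  \<comment> \<open>The second integration, now in v; the boundary term H(u,0) is supplied by the
    Goursat data.\<close>
  have "((\<lambda>\<beta>. Hv u \<beta>) has_integral H u v - H u 0) {0..v}"
    using uv by (intro fundamental_theorem_of_calculus has_vector_derivative_at_within[OF Hv]) auto
  then have "H u v - H u 0 = integral {0..v} (\<lambda>\<beta>. Hv u \<beta>)"
    by (rule integral_unique[symmetric])
  also have "\<dots> = integral {0..v} (\<lambda>\<beta>. integral {\<alpha>. (\<alpha>, \<beta>) \<in> {0..u} \<times> {0..v}} (\<lambda>\<alpha>. G (\<alpha>, \<beta>)))"
    by (rule integral_cong) (simp add: Hv_eq atLeastAtMost_def atLeast_def atMost_def Collect_conj_eq)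
  also have "\<dots> = integral UNIV (\<lambda>\<beta>. integral {\<alpha>. (\<alpha>, \<beta>) \<in> {0..u} \<times> {0..v}} (\<lambda>\<alpha>. G (\<alpha>, \<beta>)))"
    by (rule integral_UNIV_support[symmetric]) auto
  also have "\<dots> = integral ({0..u} \<times> {0..v}) G"
  proof (rule integral_compact_eq_iterated(2)[symmetric])
    show "compact ({0..u} \<times> {0..v})" by (intro compact_Times compact_Icc)
    have "continuous_on ({0..u} \<times> {0..v}) (\<lambda>p. q (fst p + snd p))"
      by (rule continuous_on_compose2[OF q]) (use uv in \<open>auto intro!: continuous_intros\<close>)
    moreover have "continuous_on ({0..u} \<times> {0..v}) (\<lambda>(u, v). H u v)"
      by (rule continuous_on_subset[OF H_cont]) (use uv in auto)
    ultimately show "continuous_on ({0..u} \<times> {0..v}) G"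
      unfolding G_def case_prod_unfold by (intro continuous_on_mult)
  qed
  moreover have "(LBINT s=0..u. q s) = integral {0..u} q"
  proof -
    have "set_integrable lborel {0..u} q"
      by (rule borel_integrable_atLeastAtMost', rule continuous_on_subset[OF q]) (use uv in auto)
    from interval_integral_eq_integral[OF uv(1) this] show ?thesis
      by (simp add: zero_ereal_def)
  qed
  ultimately show ?thesis
    using Hu0[of u] uv unfolding G_def by (simp add: algebra_simps)
qed

text \<open>Integration by parts with the primitive \<sigma>(u) \<sigma>(u - x) of \<sigma>(2u - x).
  It vanishes at u = 0 and at u = x, so no boundary terms remain, and the oddness of \<sigma>
  absorbs the minus sign.\<close>

lemma integral_sin_quot_primitive:
  assumes q: "continuous_on {0..x} q" and x: "0 \<le> x"
  shows "integral {0..x} (\<lambda>u. sin_quot \<omega> (2 * u - x) * integral {0..u} q) =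
    integral {0..x} (\<lambda>y. sin_quot \<omega> (x - y) * q y * sin_quot \<omega> y)"
proof -
  define Q where "Q = (\<lambda>u. integral {0..u} q)"
  have Q: "continuous_on {0..x} Q"
    unfolding Q_def by (intro indefinite_integral_continuous_1 integrable_continuous_interval q)
  have "((\<lambda>u. Q u * (sin_quot \<omega> u * sin_quot \<omega> (u - x))) has_vector_derivative
      Q u * sin_quot \<omega> (2 * u - x) + q u * (sin_quot \<omega> u * sin_quot \<omega> (u - x))) (at u within {0..x})"
    if "u \<in> {0..x}" for u
    using has_vector_derivative_mult[OF integral_has_vector_derivative[OF q that]
        has_vector_derivative_sin_quot_mult[of \<omega> 0 x u]]
    by (simp add: Q_def)
  from fundamental_theorem_of_calculus[OF x this]
  have "integral {0..x} (\<lambda>u. Q u * sin_quot \<omega> (2 * u - x) +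
      q u * (sin_quot \<omega> u * sin_quot \<omega> (u - x))) = 0"
    by (simp add: integral_unique)
  also have "(\<lambda>u. Q u * sin_quot \<omega> (2 * u - x) + q u * (sin_quot \<omega> u * sin_quot \<omega> (u - x))) =
      (\<lambda>u. sin_quot \<omega> (2 * u - x) * Q u - sin_quot \<omega> (x - u) * q u * sin_quot \<omega> u)"
  proof
    fix u
    have "sin_quot \<omega> (u - x) = - sin_quot \<omega> (x - u)"
      using sin_quot_minus[of \<omega> "x - u"] by simp
    then show "Q u * sin_quot \<omega> (2 * u - x) + q u * (sin_quot \<omega> u * sin_quot \<omega> (u - x)) =
        sin_quot \<omega> (2 * u - x) * Q u - sin_quot \<omega> (x - u) * q u * sin_quot \<omega> u"
      by (simp add: mult_ac)
  qed
  also have "integral {0..x} \<dots> = integral {0..x} (\<lambda>u. sin_quot \<omega> (2 * u - x) * Q u) -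
      integral {0..x} (\<lambda>y. sin_quot \<omega> (x - y) * q y * sin_quot \<omega> y)"
    by (intro Henstock_Kurzweil_Integration.integral_diff integrable_continuous_interval continuous_intros q Q)
  finally show ?thesis
    by (simp add: Q_def)
qed

text \<open>Equals $\int_0^y S_f(y,t)\,\sin(\omega t)/\omega\,dt$, by \<open>integral_S_kernel\<close>.\<close>

definition kernel_integral :: "(real \<Rightarrow> real \<Rightarrow> complex) \<Rightarrow> complex \<Rightarrow> real \<Rightarrow> complex" where
  "kernel_integral H \<omega> y = 2 * integral {0..y} (\<lambda>\<alpha>. H \<alpha> (y - \<alpha>) * sin_quot \<omega> (2 * \<alpha> - y))"

text \<open>The substitution \<alpha> = y\<tau> moves the variable end point into the integrand, so
  that continuity of a parameter integral over the fixed interval [0,1] applies.\<close>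

lemma continuous_on_kernel_integral:
  assumes H: "continuous_on {(u, v). \<bar>u\<bar> + \<bar>v\<bar> \<le> b} (\<lambda>(u, v). H u v)"
  shows "continuous_on {0..b} (kernel_integral H \<omega>)"
proof -
  define F where "F = (\<lambda>y \<tau>. H (y * \<tau>) (y - y * \<tau>) * sin_quot \<omega> (2 * (y * \<tau>) - y))"
  have "continuous_on ({0..b} \<times> cbox 0 1) (\<lambda>w. (\<lambda>(u, v). H u v) (fst w * snd w, fst w - fst w * snd w))"
  proof (rule continuous_on_compose2[OF H])
    show "(\<lambda>w. (fst w * snd w, fst w - fst w * snd w)) ` ({0..b} \<times> cbox 0 1) \<subseteq>
        {(u, v). \<bar>u\<bar> + \<bar>v\<bar> \<le> b}"
      by (auto simp: mult_left_le)
  qed (intro continuous_intros)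
  then have "continuous_on ({0..b} \<times> cbox 0 1) (\<lambda>(y, \<tau>). F y \<tau>)"
    unfolding F_def case_prod_unfold by (intro continuous_intros) simp
  then have "continuous_on {0..b} (\<lambda>y. integral (cbox 0 1) (F y))"
    by (rule integral_continuous_on_param)
  then have "continuous_on {0..b} (\<lambda>y. 2 * (of_real y * integral {0..1} (F y)))"
    by (intro continuous_intros) simp
  then show ?thesis
  proof (rule continuous_on_eq)
    fix y assume y: "y \<in> {0..b}"
    show "2 * (of_real y * integral {0..1} (F y)) = kernel_integral H \<omega> y"
    \<comment> \<open>The substitution rescales by y and degenerates at y = 0, where both sides
      vanish.\<close>
    proof (cases "y = 0")
      case False
      have "continuous_on {0..y} (\<lambda>\<alpha>. (\<lambda>(u, v). H u v) (\<alpha>, y - \<alpha>))"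
        by (rule continuous_on_compose2[OF H]) (use y in \<open>auto intro!: continuous_intros\<close>)
      then have "(\<lambda>\<alpha>. H \<alpha> (y - \<alpha>) * sin_quot \<omega> (2 * \<alpha> - y)) integrable_on {0..y}"
        by (intro integrable_continuous_interval continuous_intros) simp
      from has_integral_affinity'[OF this[THEN integrable_integral, folded box_real], of y 0]
      have "(F y has_integral integral {0..y} (\<lambda>\<alpha>. H \<alpha> (y - \<alpha>) * sin_quot \<omega> (2 * \<alpha> - y)) /\<^sub>R y) {0..1}"
        using False y by (simp add: F_def[abs_def])
      then show ?thesis
        using False by (simp add: kernel_integral_def integral_unique scaleR_conv_of_real)
    qed (simp add: kernel_integral_def)
  qed
qed

text \<open>The integrated Goursat problem splits H on the line u + v = x into h/2,
  \<open>Q\<close>/2 and \<open>R\<close>. Against \<open>p\<close> the constant integrates to zero,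
  \<open>Q\<close> gives the term with \<sigma>(y) by parts, and \<open>R\<close> gives the term
  with the kernel integral by Fubini. The bound x < b is inherited from
  \<open>goursat_integral_equation\<close>.\<close>

lemma kernel_integral_equation:
  assumes H: "goursat_solution b q h H" and q: "continuous_on {-b..b} q"
    and x: "0 \<le> x" "x < b"
  shows "kernel_integral H \<omega> x =
    integral {0..x} (\<lambda>y. sin_quot \<omega> (x - y) * q y * (sin_quot \<omega> y + kernel_integral H \<omega> y))"
proof -
  define I where "I = kernel_integral H \<omega>"
  define p where "p = (\<lambda>u. sin_quot \<omega> (2 * u - x))"
  define Q where "Q = (\<lambda>u. integral {0..u} q)"
  define G where "G = (\<lambda>\<alpha> \<beta>. q (\<alpha> + \<beta>) * H \<alpha> \<beta>)"
  define R where "R = (\<lambda>u. integral ({0..u} \<times> {0..x - u}) (\<lambda>(\<alpha>, \<beta>). G \<alpha> \<beta>))"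
  have H_cont: "continuous_on {(u, v). \<bar>u\<bar> + \<bar>v\<bar> \<le> b} (\<lambda>(u, v). H u v)"
    using H unfolding goursat_solution_def by blast
  have q': "continuous_on {0..x} q"
    using q by (rule continuous_on_subset) (use x in auto)
  have p: "continuous_on {0..x} p"
    unfolding p_def by (intro continuous_intros)
  have Q: "continuous_on {0..x} Q"
    unfolding Q_def by (intro indefinite_integral_continuous_1 integrable_continuous_interval q')
  have G: "continuous_on (triangle x) (\<lambda>(\<alpha>, \<beta>). G \<alpha> \<beta>)"
  proof -
    have "continuous_on (triangle x) (\<lambda>w. q (fst w + snd w))"
      by (rule continuous_on_compose2[OF q]) (use x in \<open>auto intro!: continuous_intros simp: triangle_def\<close>)
    moreover have "continuous_on (triangle x) (\<lambda>(u, v). H u v)"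
      by (rule continuous_on_subset[OF H_cont]) (use x in \<open>auto simp: triangle_def\<close>)
    ultimately show ?thesis
      unfolding G_def case_prod_unfold by (intro continuous_on_mult)
  qed
  have HI: "continuous_on {0..x} (\<lambda>u. H u (x - u))"
  proof -
    have "continuous_on {0..x} (\<lambda>u. (\<lambda>(u, v). H u v) (u, x - u))"
      by (rule continuous_on_compose2[OF H_cont]) (use x in \<open>auto intro!: continuous_intros\<close>)
    then show ?thesis by simp
  qed
  have H_eq: "H u (x - u) = h / 2 + 1 / 2 * Q u + R u" if "u \<in> {0..x}" for u
    using goursat_integral_equation[OF H q, of u "x - u"] that x by (simp add: Q_def R_def G_def)
  \<comment> \<open>Continuity of \<open>R\<close> is read off from \<open>H_eq\<close>, as a
    difference of continuous functions, rather than from its form as an integral over a varying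
    rectangle.\<close>
  have pR: "continuous_on {0..x} (\<lambda>u. p u * R u)"
  proof -
    have "continuous_on {0..x} (\<lambda>u. p u * (H u (x - u) - h / 2 - 1 / 2 * Q u))"
      by (intro continuous_intros p Q HI)
    then show ?thesis
      by (rule continuous_on_eq) (simp add: H_eq)
  qed
  \<comment> \<open>The closed form separates the characteristic variables: one factor depends only
    on \<alpha> + \<beta>, the other only on \<alpha> - \<beta>.\<close>
  have inner: "integral {\<alpha>..x - \<beta>} p = sin_quot \<omega> (x - (\<alpha> + \<beta>)) * sin_quot \<omega> (\<alpha> - \<beta>)"
    if "(\<alpha>, \<beta>) \<in> triangle x" for \<alpha> \<beta>
    using has_integral_sin_quot[of \<alpha> "x - \<beta>" \<omega> x] that
    by (auto simp: p_def triangle_def algebra_simps dest!: integral_unique)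
  have p_zero: "integral {0..x} p = 0"
    using has_integral_sin_quot[of 0 x \<omega> x] x by (simp add: p_def integral_unique)
  have "integral {0..x} (\<lambda>u. p u * R u) = integral (triangle x) (\<lambda>(\<alpha>, \<beta>). G \<alpha> \<beta> * integral {\<alpha>..x - \<beta>} p)"
    unfolding R_def by (rule integral_mult_rectangle_integrals[OF p G])
  also have "\<dots> = integral (triangle x)
      (\<lambda>(\<alpha>, \<beta>). G \<alpha> \<beta> * (sin_quot \<omega> (x - (\<alpha> + \<beta>)) * sin_quot \<omega> (\<alpha> - \<beta>)))"
    by (rule integral_cong) (auto simp: inner)
  also have "\<dots> = integral {0..x} (\<lambda>y. integral {0..y}
      (\<lambda>\<alpha>. G \<alpha> (y - \<alpha>) * (sin_quot \<omega> (x - (\<alpha> + (y - \<alpha>))) * sin_quot \<omega> (\<alpha> - (y - \<alpha>)))))"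
  proof (rule integral_triangle_diagonals)
    have "continuous_on (triangle x) (\<lambda>w. (\<lambda>(\<alpha>, \<beta>). G \<alpha> \<beta>) w *
        (sin_quot \<omega> (x - (fst w + snd w)) * sin_quot \<omega> (fst w - snd w)))"
      by (intro continuous_on_mult G continuous_intros)
    then show "continuous_on (triangle x)
        (\<lambda>(\<alpha>, \<beta>). G \<alpha> \<beta> * (sin_quot \<omega> (x - (\<alpha> + \<beta>)) * sin_quot \<omega> (\<alpha> - \<beta>)))"
      by (simp add: case_prod_unfold)
  qed
  \<comment> \<open>On the diagonal \<alpha> + \<beta> = y the factors \<sigma>(x - y) and q(y) are
    constant; what remains under the inner integral is half of the kernel integral at y.\<close>
  also have "\<dots> = integral {0..x} (\<lambda>y. sin_quot \<omega> (x - y) * q y * (I y / 2))"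
  proof (rule integral_cong)
    fix y
    have "integral {0..y} (\<lambda>\<alpha>. G \<alpha> (y - \<alpha>) *
        (sin_quot \<omega> (x - (\<alpha> + (y - \<alpha>))) * sin_quot \<omega> (\<alpha> - (y - \<alpha>)))) =
      integral {0..y} (\<lambda>\<alpha>. sin_quot \<omega> (x - y) * q y * (H \<alpha> (y - \<alpha>) * sin_quot \<omega> (2 * \<alpha> - y)))"
      by (rule integral_cong) (simp add: G_def)
    then show "integral {0..y} (\<lambda>\<alpha>. G \<alpha> (y - \<alpha>) *
        (sin_quot \<omega> (x - (\<alpha> + (y - \<alpha>))) * sin_quot \<omega> (\<alpha> - (y - \<alpha>)))) =
      sin_quot \<omega> (x - y) * q y * (I y / 2)"
      by (simp add: I_def kernel_integral_def)
  qed
  finally have R_part: "2 * integral {0..x} (\<lambda>u. p u * R u) =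
      integral {0..x} (\<lambda>y. sin_quot \<omega> (x - y) * q y * I y)"
    by (simp add: mult.commute)
  have "I x = 2 * integral {0..x} (\<lambda>u. h / 2 * p u + (1 / 2 * (p u * Q u) + p u * R u))"
    unfolding I_def kernel_integral_def
    by (intro arg_cong[where f = "\<lambda>z. 2 * z"] integral_cong) (simp add: H_eq p_def algebra_simps)
  also have "\<dots> = integral {0..x} (\<lambda>u. p u * Q u) + 2 * integral {0..x} (\<lambda>u. p u * R u)"
    using p Q pR p_zero
    by (subst integral_add; (subst integral_add)?)
      (auto intro!: integrable_continuous_interval continuous_intros)
  also have "\<dots> = integral {0..x} (\<lambda>y. sin_quot \<omega> (x - y) * q y * sin_quot \<omega> y) +
      integral {0..x} (\<lambda>y. sin_quot \<omega> (x - y) * q y * I y)"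
    unfolding R_part using integral_sin_quot_primitive[OF q' x(1)] by (simp add: p_def Q_def)
  also have "\<dots> = integral {0..x} (\<lambda>y. sin_quot \<omega> (x - y) * q y * (sin_quot \<omega> y + I y))"
  proof (subst integral_add[symmetric])
    have "continuous_on {0..x} I"
      unfolding I_def by (rule continuous_on_subset[OF continuous_on_kernel_integral[OF H_cont]])
        (use x in auto)
    then show "(\<lambda>y. sin_quot \<omega> (x - y) * q y * I y) integrable_on {0..x}"
      by (intro integrable_continuous_interval continuous_intros q')
    show "(\<lambda>y. sin_quot \<omega> (x - y) * q y * sin_quot \<omega> y) integrable_on {0..x}"
      by (intro integrable_continuous_interval continuous_intros q')
  qed (simp add: distrib_left)
  finally show ?thesis by (simp add: I_def)
qed

section \<open>Variation of constants and uniqueness\<close>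

text \<open>Variation of constants: the function \<sigma>(x - y) s'(y) + cos(\<omega>(x - y)) s(y)
  of y has derivative \<sigma>(x - y) q(y) s(y), because the terms with s' and with
  \<open>\<omega>\<^sup>2\<close> cancel.\<close>

lemma s_solution_integral_equation:
  assumes s: "is_s_solution b q \<omega> s" and b: "b > 0" and x: "0 \<le> x" "x \<le> b"
  shows "s x = sin_quot \<omega> x + integral {0..x} (\<lambda>y. sin_quot \<omega> (x - y) * q y * s y)"
proof -
  obtain s' s'' where
    s': "\<And>y. y \<in> {-b..b} \<Longrightarrow> (s has_vector_derivative s' y) (at y within {-b..b})" and
    s'': "\<And>y. y \<in> {-b..b} \<Longrightarrow> (s' has_vector_derivative s'' y) (at y within {-b..b})" and
    ode: "\<And>y. y \<in> {-b..b} \<Longrightarrow> s'' y - q y * s y + \<omega>\<^sup>2 * s y = 0"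
    using s unfolding is_s_solution_def schroedinger_solution_def by blast
  have s0: "s 0 = 0" and ds0: "vector_derivative s (at 0) = 1"
    using s by (auto simp: is_s_solution_def)
  \<comment> \<open>Since b > 0, the point 0 is interior, so the derivative within [-b,b] is the
    two-sided one that the initial condition prescribes.\<close>
  have "(s has_vector_derivative s' 0) (at 0)"
    using s'[of 0] b by (simp add: at_within_Icc_at)
  then have s'0: "s' 0 = 1"
    using ds0 vector_derivative_at by force
  have sub: "{0..x} \<subseteq> {-b..b}"
    using x by auto
  have refl: "((\<lambda>y. x - y) has_vector_derivative - 1) (at y within {0..x})" for y
    by (auto intro!: derivative_eq_intros)
  have dsin: "((\<lambda>y. sin_quot \<omega> (x - y)) has_vector_derivative - cos (\<omega> * of_real (x - y)))
      (at y within {0..x})" for y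
    using vector_diff_chain_within[OF refl has_vector_derivative_sin_quot] by (simp add: o_def)
  have dcos: "((\<lambda>y. cos (\<omega> * of_real (x - y))) has_vector_derivative \<omega>\<^sup>2 * sin_quot \<omega> (x - y))
      (at y within {0..x})" for y
    using vector_diff_chain_within[OF refl has_vector_derivative_cos_mult] by (simp add: o_def)
  have "((\<lambda>y. sin_quot \<omega> (x - y) * s' y + cos (\<omega> * of_real (x - y)) * s y) has_vector_derivative
      sin_quot \<omega> (x - y) * q y * s y) (at y within {0..x})" if y: "y \<in> {0..x}" for y
  proof (rule has_vector_derivative_eq_rhs)
    show "((\<lambda>y. sin_quot \<omega> (x - y) * s' y + cos (\<omega> * of_real (x - y)) * s y) has_vector_derivative
        (sin_quot \<omega> (x - y) * s'' y + - cos (\<omega> * of_real (x - y)) * s' y) +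
        (cos (\<omega> * of_real (x - y)) * s' y + \<omega>\<^sup>2 * sin_quot \<omega> (x - y) * s y)) (at y within {0..x})"
      using y sub by (intro has_vector_derivative_add has_vector_derivative_mult dsin dcos
        has_vector_derivative_within_subset[OF s' sub] has_vector_derivative_within_subset[OF s'' sub]) auto
    have s''_eq: "s'' y = q y * s y - \<omega>\<^sup>2 * s y"
      using ode[of y] y sub by (auto simp: algebra_simps)
    show "(sin_quot \<omega> (x - y) * s'' y + - cos (\<omega> * of_real (x - y)) * s' y) +
        (cos (\<omega> * of_real (x - y)) * s' y + \<omega>\<^sup>2 * sin_quot \<omega> (x - y) * s y) =
        sin_quot \<omega> (x - y) * q y * s y"
      unfolding s''_eq by (simp add: algebra_simps)
  qed
  \<comment> \<open>The end values are s(x) at y = x, by \<sigma>(0) = 0 and cos 0 = 1, and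
    \<sigma>(x) at y = 0, by the initial conditions.\<close>
  from fundamental_theorem_of_calculus[OF x(1) this] show ?thesis
    by (simp add: integral_unique s0 s'0)
qed

text \<open>A Gronwall argument by iteration: starting from a bound \<open>A\<close> on the compact
  interval, n uses of the inequality improve it to a multiple of the n-th term of the exponential
  series at Mx, which tends to zero.\<close>

lemma norm_le_integral_imp_zero:
  fixes D :: "real \<Rightarrow> 'a::banach"
  assumes D: "continuous_on {0..c} D"
    and le: "\<And>x. x \<in> {0..c} \<Longrightarrow> norm (D x) \<le> M * integral {0..x} (\<lambda>y. norm (D y))"
    and M: "0 \<le> M" and x: "x \<in> {0..c}"
  shows "D x = 0"
proof -
  have "bounded (D ` {0..c})"
    by (intro compact_imp_bounded compact_continuous_image D compact_Icc)
  then obtain A where A: "\<And>y. y \<in> {0..c} \<Longrightarrow> norm (D y) \<le> A"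
    unfolding bounded_iff by blast
  have iter: "norm (D y) \<le> A * ((M * y) ^ n / fact n)" if "y \<in> {0..c}" for y n
    using that
  proof (induction n arbitrary: y)
    case 0
    then show ?case using A by simp
  next
    case (Suc n)
    have "((\<lambda>t. A * M ^ n / fact (Suc n) * t ^ Suc n) has_vector_derivative A * ((M * t) ^ n / fact n))
        (at t within {0..y})" for t
      unfolding has_real_derivative_iff_has_vector_derivative[symmetric]
    proof (rule DERIV_cong)
      show "((\<lambda>t. A * M ^ n / fact (Suc n) * t ^ Suc n) has_real_derivative
          A * M ^ n / fact (Suc n) * (real (Suc n) * t ^ (Suc n - Suc 0))) (at t within {0..y})"
        by (rule DERIV_cmult[OF DERIV_pow])
    qed (simp add: power_mult_distrib divide_simps del: of_nat_Suc)
    from fundamental_theorem_of_calculus[OF _ this] Suc.prems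
    have int: "((\<lambda>t. A * ((M * t) ^ n / fact n)) has_integral A * M ^ n / fact (Suc n) * y ^ Suc n) {0..y}"
      by simp
    have "norm (D y) \<le> M * integral {0..y} (\<lambda>t. norm (D t))"
      using le Suc.prems by blast
    also have "integral {0..y} (\<lambda>t. norm (D t)) \<le> integral {0..y} (\<lambda>t. A * ((M * t) ^ n / fact n))"
    proof (rule integral_le)
      show "(\<lambda>t. norm (D t)) integrable_on {0..y}"
        by (intro integrable_continuous_interval continuous_on_norm continuous_on_subset[OF D])
          (use Suc.prems in auto)
    qed (use int Suc in \<open>auto simp: integrable_on_def\<close>)
    also have "M * \<dots> = A * ((M * y) ^ Suc n / fact (Suc n))"
      unfolding integral_unique[OF int] by (simp add: power_mult_distrib mult_ac)
    finally show ?case using M by (simp add: mult_left_mono)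
  qed
  have "(\<lambda>n. (M * x) ^ n / fact n) \<longlonglongrightarrow> 0"
    using summable_LIMSEQ_zero[OF summable_exp[of "M * x"]] by (simp add: divide_inverse mult.commute)
  from tendsto_mult_left[OF this, of A] have "norm (D x) \<le> 0"
    by (intro LIMSEQ_le_const) (use iter[OF x] in auto)
  then show ?thesis by simp
qed

text \<open>Both sides solve the same Volterra equation on [0,b), so their difference
  \<open>D\<close> solves the homogeneous one and vanishes there by the Gronwall argument.\<close>

lemma s_solution_eq_kernel_integral:
  assumes s: "is_s_solution b q \<omega> s" and H: "goursat_solution b q h H"
    and q: "continuous_on {-b..b} q" and b: "b > 0" and x: "x \<in> {0..b}"
  shows "s x = sin_quot \<omega> x + kernel_integral H \<omega> x"
proof -
  define D where "D = (\<lambda>x. s x - (sin_quot \<omega> x + kernel_integral H \<omega> x))"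
  have H_cont: "continuous_on {(u, v). \<bar>u\<bar> + \<bar>v\<bar> \<le> b} (\<lambda>(u, v). H u v)"
    using H unfolding goursat_solution_def by blast
  note KI = continuous_on_kernel_integral[OF H_cont, of \<omega>]
  have s_cont: "continuous_on {0..b} s"
  proof -
    have "continuous_on {-b..b} s"
      using s unfolding is_s_solution_def schroedinger_solution_def
      by (meson continuous_on_eq_continuous_within has_vector_derivative_continuous)
    then show ?thesis by (rule continuous_on_subset) (use b in auto)
  qed
  have D: "continuous_on {0..b} D"
    unfolding D_def by (intro continuous_intros s_cont KI)
  have qb: "continuous_on {0..b} q"
    using q by (rule continuous_on_subset) (use b in auto)
  have "bounded ((\<lambda>(x, y). sin_quot \<omega> (x - y) * q y) ` ({0..b} \<times> {0..b}))"
    unfolding case_prod_unfold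
    by (intro compact_imp_bounded compact_continuous_image compact_Times compact_Icc continuous_intros
        continuous_on_compose2[OF qb]) auto
  then obtain M where M: "M > 0"
    "\<And>x y. x \<in> {0..b} \<Longrightarrow> y \<in> {0..b} \<Longrightarrow> norm (sin_quot \<omega> (x - y) * q y) \<le> M"
    unfolding bounded_pos by fastforce
  have D_eq: "D x = integral {0..x} (\<lambda>y. sin_quot \<omega> (x - y) * q y * D y)" if "0 \<le> x" "x < b" for x
  proof -
    have sub: "{0..x} \<subseteq> {0..b}" using that by auto
    note [continuous_intros] = continuous_on_subset[OF s_cont sub]
      continuous_on_subset[OF KI sub] continuous_on_subset[OF qb sub]
    have "D x = integral {0..x} (\<lambda>y. sin_quot \<omega> (x - y) * q y * s y) -
        integral {0..x} (\<lambda>y. sin_quot \<omega> (x - y) * q y * (sin_quot \<omega> y + kernel_integral H \<omega> y))"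
      unfolding D_def
      using s_solution_integral_equation[OF s b, of x] kernel_integral_equation[OF H q that, of \<omega>] that
      by simp
    also have "\<dots> = integral {0..x} (\<lambda>y. sin_quot \<omega> (x - y) * q y * s y -
        sin_quot \<omega> (x - y) * q y * (sin_quot \<omega> y + kernel_integral H \<omega> y))"
      by (intro Henstock_Kurzweil_Integration.integral_diff[symmetric]
          integrable_continuous_interval continuous_intros)
    finally show ?thesis
      by (simp add: D_def right_diff_distrib)
  qed
  have zero: "D y = 0" if y: "y \<in> {0..<b}" for y
  proof (rule norm_le_integral_imp_zero)
    show "continuous_on {0..y} D"
      by (rule continuous_on_subset[OF D]) (use y in auto)
    fix z assume z: "z \<in> {0..y}"
    have sub: "{0..z} \<subseteq> {0..b}" using y z by auto
    note [continuous_intros] = continuous_on_subset[OF D sub] continuous_on_subset[OF qb sub]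
    have "norm (D z) = norm (integral {0..z} (\<lambda>y. sin_quot \<omega> (z - y) * q y * D y))"
      using D_eq[of z] y z by simp
    also have "\<dots> \<le> integral {0..z} (\<lambda>y. M * norm (D y))"
    proof (rule Henstock_Kurzweil_Integration.integral_norm_bound_integral)
      fix t assume "t \<in> {0..z}"
      then show "norm (sin_quot \<omega> (z - t) * q t * D t) \<le> M * norm (D t)"
        unfolding norm_mult[of _ "D t"] using M(2)[of z t] y z by (intro mult_right_mono) auto
    qed (intro integrable_continuous_interval continuous_intros)+
    finally show "norm (D z) \<le> M * integral {0..z} (\<lambda>y. norm (D y))"
      by simp
  qed (use M y in auto)
  \<comment> \<open>The kernel equation stops short of b; continuity of \<open>D\<close> carries the
    zero over to the end point.\<close>
  have "D x = 0"
  proof (rule continuous_constant_on_closure[where f = D and S = "{0..<b}"])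
    show "continuous_on (closure {0..<b}) D"
      using D b by simp
    show "x \<in> closure {0..<b}"
      using x b by simp
  qed (rule zero)
  then show ?thesis by (simp add: D_def)
qed

section \<open>Return to the kernel in the variables (x,t)\<close>

text \<open>The substitution t = 2u - x turns the integral of K \<sigma> over [-x,x] into the kernel
  integral, with Jacobian 2. Folding [-x,0] onto [0,x] then produces K(x,t) - K(x,-t), since
  \<sigma> is odd.\<close>

lemma integral_S_kernel:
  assumes H: "continuous_on {(u, v). \<bar>u\<bar> + \<bar>v\<bar> \<le> b} (\<lambda>(u, v). H u v)" and x: "x \<in> {0..b}"
  shows "continuous_on {0..x} (S_kernel H x)"
    and "integral {0..x} (\<lambda>t. S_kernel H x t * sin_quot \<omega> t) = kernel_integral H \<omega> x"
proof -
  have K: "continuous_on {-x..x} (K_kernel H x)"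
  proof -
    have "continuous_on {-x..x} (\<lambda>t. (\<lambda>(u, v). H u v) ((x + t) / 2, (x - t) / 2))"
      by (rule continuous_on_compose2[OF H]) (use x in \<open>auto intro!: continuous_intros simp: abs_if field_simps\<close>)
    then show ?thesis by (simp add: K_kernel_def[abs_def])
  qed
  have K1: "continuous_on {0..x} (K_kernel H x)"
    by (rule continuous_on_subset[OF K]) (use x in auto)
  have K2: "continuous_on {0..x} (\<lambda>t. K_kernel H x (- t))"
    by (rule continuous_on_compose2[OF K]) (auto intro!: continuous_intros)
  show "continuous_on {0..x} (S_kernel H x)"
    unfolding S_kernel_def[abs_def] by (intro continuous_intros K1 K2)
  define g where "g = (\<lambda>t. K_kernel H x t * sin_quot \<omega> t)"
  have g: "g integrable_on {-x..x}"
    unfolding g_def by (intro integrable_continuous_interval continuous_intros K)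
  have g_eq: "g (2 * u - x) = H u (x - u) * sin_quot \<omega> (2 * u - x)" for u
    by (simp add: g_def K_kernel_def diff_divide_distrib)
  from has_integral_affinity'[OF g[THEN integrable_integral, folded box_real], of 2 "- x"]
  have "((\<lambda>u. H u (x - u) * sin_quot \<omega> (2 * u - x)) has_integral integral {-x..x} g /\<^sub>R 2) {0..x}"
    by (simp add: g_eq)
  then have "kernel_integral H \<omega> x = integral {-x..x} g"
    by (simp add: kernel_integral_def integral_unique scaleR_conv_of_real)
  also have "\<dots> = integral {-x..0} g + integral {0..x} g"
    using x g by (intro Henstock_Kurzweil_Integration.integral_combine[symmetric]) auto
  also have "integral {-x..0} g = integral {0..x} (\<lambda>t. g (- t))"
    using Henstock_Kurzweil_Integration.integral_reflect_real[of x 0 "\<lambda>t. g (- t)"] by simp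
  also have "\<dots> + integral {0..x} g = integral {0..x} (\<lambda>t. g (- t) + g t)"
    unfolding g_def sin_quot_minus
    by (intro integral_add[symmetric] integrable_continuous_interval continuous_intros K1 K2)
  finally show "integral {0..x} (\<lambda>t. S_kernel H x t * sin_quot \<omega> t) = kernel_integral H \<omega> x"
    by (simp add: g_def S_kernel_def algebra_simps)
qed

text \<open>For fixed x this is a polynomial in t.\<close>

lemma continuous_on_S_approx: "continuous_on A (S_approx f \<beta> N x)"
  unfolding S_approx_def[abs_def] u_even_def by (intro continuous_intros)

lemma s_solution_minus_s_approx:
  assumes s: "is_s_solution b q \<omega> s" and H: "goursat_solution b q h H"
    and q: "continuous_on {-b..b} q" and b: "b > 0" and x: "x \<in> {0..b}"
  shows "s x - s_approx f \<beta> N \<omega> x =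
    integral {0..x} (\<lambda>t. (S_kernel H x t - S_approx f \<beta> N x t) * sin_quot \<omega> t)"
proof -
  have H_cont: "continuous_on {(u, v). \<bar>u\<bar> + \<bar>v\<bar> \<le> b} (\<lambda>(u, v). H u v)"
    using H unfolding goursat_solution_def by blast
  note S = integral_S_kernel[OF H_cont x]
  have "set_integrable lborel {0..x} (\<lambda>t. S_approx f \<beta> N x t * sin_quot \<omega> t)"
    by (intro borel_integrable_atLeastAtMost' continuous_intros continuous_on_S_approx)
  from interval_integral_eq_integral[OF _ this] x
  have "s_approx f \<beta> N \<omega> x = sin_quot \<omega> x + integral {0..x} (\<lambda>t. S_approx f \<beta> N x t * sin_quot \<omega> t)"
    by (simp add: s_approx_def zero_ereal_def)
  then have "s x - s_approx f \<beta> N \<omega> x = integral {0..x} (\<lambda>t. S_kernel H x t * sin_quot \<omega> t) -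
      integral {0..x} (\<lambda>t. S_approx f \<beta> N x t * sin_quot \<omega> t)"
    using s_solution_eq_kernel_integral[OF s H q b x] S(2) by simp
  also have "\<dots> = integral {0..x} (\<lambda>t. S_kernel H x t * sin_quot \<omega> t - S_approx f \<beta> N x t * sin_quot \<omega> t)"
    by (intro Henstock_Kurzweil_Integration.integral_diff[symmetric] integrable_continuous_interval
        continuous_intros S(1) continuous_on_S_approx)
  finally show ?thesis
    by (simp add: left_diff_distrib)
qed

section \<open>The three error estimates\<close>

theorem proposition6p3:
  fixes b :: real
  assumes "b > 0"
  shows "\<exists>c\<^sub>b :: real.
    \<forall>(q :: real \<Rightarrow> complex) (f :: real \<Rightarrow> complex) (H :: real \<Rightarrow> real \<Rightarrow> complex)
     (s :: real \<Rightarrow> complex) (N :: nat) (\<beta> :: nat \<Rightarrow> complex) (\<omega> :: complex)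
     (C :: real) (\<epsilon> :: real) (x :: real).
      continuous_on {-b..b} q \<longrightarrow>
      schroedinger_solution b q 0 f \<longrightarrow>
      (\<forall>y\<in>{-b..b}. f y \<noteq> 0) \<longrightarrow>
      f 0 = 1 \<longrightarrow>
      goursat_solution b q (vector_derivative f (at 0)) H \<longrightarrow>
      is_s_solution b q \<omega> s \<longrightarrow>
      C > 0 \<longrightarrow>
      \<bar>Im \<omega>\<bar> \<le> C \<longrightarrow>
      (\<forall>y\<in>{-b..b}. \<forall>t\<in>{-b..b}. cmod (S_kernel H y t - S_approx f \<beta> N y t) \<le> \<epsilon>) \<longrightarrow>
      x \<in> {0..b} \<longrightarrow>
        (cmod \<omega> > 1 \<longrightarrow> cmod (s x - s_approx f \<beta> N \<omega> x) \<le> \<epsilon> * (sinh (C * x) / C)) \<and>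
        (cmod \<omega> \<le> 1 \<longrightarrow> cmod (s x - s_approx f \<beta> N \<omega> x) \<le> \<epsilon> * c\<^sub>b * x) \<and>
        (\<omega> \<noteq> 0 \<longrightarrow> cmod (s x - s_approx f \<beta> N \<omega> x) \<le> \<epsilon> / cmod \<omega> * (sinh (C * x) / C))"
\<comment> \<open>The witness is the bound for \<sigma> from \<open>norm_sin_quot_le_exp\<close>; it
  is chosen before q, f and all the other data.\<close>
proof (intro exI[of _ "b * exp b"] allI impI)
  fix q f :: "real \<Rightarrow> complex" and H :: "real \<Rightarrow> real \<Rightarrow> complex" and s :: "real \<Rightarrow> complex"
    and N :: nat and \<beta> :: "nat \<Rightarrow> complex" and \<omega> :: complex and C \<epsilon> x :: real
  assume q: "continuous_on {-b..b} q"
    and H: "goursat_solution b q (vector_derivative f (at 0)) H"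
    and s: "is_s_solution b q \<omega> s"
    and C: "C > 0" "\<bar>Im \<omega>\<bar> \<le> C"
    and \<epsilon>: "\<forall>y\<in>{-b..b}. \<forall>t\<in>{-b..b}. cmod (S_kernel H y t - S_approx f \<beta> N y t) \<le> \<epsilon>"
    and x: "x \<in> {0..b}"
  define err where "err = cmod (s x - s_approx f \<beta> N \<omega> x)"
  have H_cont: "continuous_on {(u, v). \<bar>u\<bar> + \<bar>v\<bar> \<le> b} (\<lambda>(u, v). H u v)"
    using H unfolding goursat_solution_def by blast
  \<comment> \<open>\<epsilon> dominates a norm at some point of the square, which is nonempty
    because b > 0.\<close>
  have "0 \<le> \<epsilon>"
    using \<epsilon> assms by (force intro: order_trans[OF norm_ge_zero])
  \<comment> \<open>Common scheme: a majorant g of |\<sigma>| on [0,x] bounds the error by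
    \<epsilon> times the integral of g. The factor \<epsilon> comes from the row of the square at
    the given x.\<close>
  have err_le: "err \<le> \<epsilon> * i"
    if "(g has_integral i) {0..x}" "\<And>t. t \<in> {0..x} \<Longrightarrow> cmod (sin_quot \<omega> t) \<le> g t" for g i
  proof -
    have "err \<le> integral {0..x} (\<lambda>t. \<epsilon> * g t)"
      unfolding err_def s_solution_minus_s_approx[OF s H q assms x]
    proof (rule Henstock_Kurzweil_Integration.integral_norm_bound_integral)
      show "(\<lambda>t. (S_kernel H x t - S_approx f \<beta> N x t) * sin_quot \<omega> t) integrable_on {0..x}"
        by (intro integrable_continuous_interval continuous_intros integral_S_kernel(1)[OF H_cont x]
            continuous_on_S_approx)
      show "cmod ((S_kernel H x t - S_approx f \<beta> N x t) * sin_quot \<omega> t) \<le> \<epsilon> * g t" if "t \<in> {0..x}" for t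
        unfolding norm_mult using \<epsilon> that x \<open>0 \<le> \<epsilon>\<close>
        by (intro mult_mono \<open>t \<in> {0..x} \<Longrightarrow> cmod (sin_quot \<omega> t) \<le> g t\<close>) auto
      show "(\<lambda>t. \<epsilon> * g t) integrable_on {0..x}"
        using that(1) by (auto simp: integrable_on_def intro: has_integral_mult_right)
    qed
    then show ?thesis
      using that(1) by (simp add: integral_unique)
  qed
  have iii: "err \<le> \<epsilon> / cmod \<omega> * (sinh (C * x) / C)" if "\<omega> \<noteq> 0"
  proof -
    have "((\<lambda>t. sinh (C * t) / C / cmod \<omega>) has_vector_derivative cosh (C * t) / cmod \<omega>) (at t within {0..x})" for t
      unfolding has_real_derivative_iff_has_vector_derivative[symmetric]
      using C(1) that by (auto intro!: derivative_eq_intros)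
    from fundamental_theorem_of_calculus[OF _ this] x
    have "((\<lambda>t. cosh (C * t) / cmod \<omega>) has_integral sinh (C * x) / C / cmod \<omega>) {0..x}"
      by simp
    from err_le[OF this norm_sin_quot_le_cosh[OF that C(2)]] show ?thesis
      by (simp add: mult_ac)
  qed
  \<comment> \<open>This follows from (iii), as dividing \<epsilon> by |\<omega>| > 1 does not
    increase it.\<close>
  moreover have "err \<le> \<epsilon> * (sinh (C * x) / C)" if "cmod \<omega> > 1"
  proof -
    have "0 \<le> sinh (C * x) / C"
      using C(1) x by simp
    moreover have "\<epsilon> / cmod \<omega> \<le> \<epsilon>"
      using that \<open>0 \<le> \<epsilon>\<close> mult_left_mono[of 1 "cmod \<omega>" \<epsilon>] by (simp add: divide_le_eq)
    moreover have "\<omega> \<noteq> 0" using that by auto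
    ultimately show ?thesis
      using iii mult_right_mono order_trans by blast
  qed
  \<comment> \<open>Here the majorant is constant, so integration only contributes the factor
    x.\<close>
  moreover have "err \<le> \<epsilon> * (b * exp b) * x" if "cmod \<omega> \<le> 1"
  proof -
    have "((\<lambda>t. b * exp b) has_integral x * (b * exp b)) {0..x}"
      using has_integral_const_real[of "b * exp b" 0 x] x by simp
    from err_le[OF this] norm_sin_quot_le_exp[OF that] x show ?thesis
      by (simp add: mult_ac)
  qed
  ultimately show "(cmod \<omega> > 1 \<longrightarrow> cmod (s x - s_approx f \<beta> N \<omega> x) \<le> \<epsilon> * (sinh (C * x) / C)) \<and>
      (cmod \<omega> \<le> 1 \<longrightarrow> cmod (s x - s_approx f \<beta> N \<omega> x) \<le> \<epsilon> * (b * exp b) * x) \<and>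
      (\<omega> \<noteq> 0 \<longrightarrow> cmod (s x - s_approx f \<beta> N \<omega> x) \<le> \<epsilon> / cmod \<omega> * (sinh (C * x) / C))"
    unfolding err_def by blast
qed

end
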